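(* Let $K:\mathbb{R}^n\to\mathbb{R}$ be a measurable function with $K(z)\ge 0$, $K(-z)=K(z)$ and $\int_{\mathbb{R}^n}\min(1,|z|)K(z)\,dz<\infty$, and let $\Omega\subset\mathbb{R}^n$ be a bounded open set. Let $F$ and $E$ be measurable subsets of $\mathbb{R}^n$ such that $F\subset E$ and $F\setminus\Omega=E\setminus\Omega$. Given a measurable function $\phi:E\setminus F\to\mathbb{R}$, define $\phi_E:\mathbb{R}^n\to[-\infty,+\infty]$ by $$\phi_E(x)=\begin{cases}+\infty & \text{if } x\in F,\\ \phi(x) & \text{if } x\in E\setminus F,\\ -\infty & \text{if } x\notin E.\end{cases}$$ Assume that there exist constants $C_0\in\mathbb{R}$ and $\varepsilon_0>0$ such that $$H_{K_\varepsilon}[\phi_E](x)\le C_0\quad\text{for a.e. } x\in E\setminus F \text{ and every } \varepsilon\in(0,\varepsilon_0).$$ Then, if $\mathcal{P}_\Omega(F)<+\infty$, we have $$\mathcal{P}_\Omega(E)\le\mathcal{P}_\Omega(F)+\int_{E\setminus F}\tilde H_K[\phi_E](x)\,dx<+\infty.$$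
   Context: Notation: $A^c=\mathbb{R}^n\setminus A$. For disjoint measurable sets $A,B$, $\mathcal{L}(A,B)=\int_A\int_B K(x-y)\,dy\,dx$. The $K$-nonlocal perimeter of $E$ inside $\Omega$ is $\mathcal{P}_\Omega(E)=\mathcal{L}(E\cap\Omega,E^c\cap\Omega)+\mathcal{L}(E\cap\Omega,E^c\cap\Omega^c)+\mathcal{L}(E^c\cap\Omega,E\cap\Omega^c)$. $\operatorname{sign}(t)=-1,0,1$ for $t<0$, $t=0$, $t>0$ respectively, with $\operatorname{sign}(-\infty)=-1$ and $\operatorname{sign}(+\infty)=1$. For $\varepsilon>0$, $K_\varepsilon(z)=K(z)$ if $z\in\mathbb{R}^n\setminus B_\varepsilon(0)$ and $K_\varepsilon(z)=0$ otherwise. For a measurable $\phi_E:\mathbb{R}^n\to[-\infty,+\infty]$ and $x$ with $\phi_E(x)\in\mathbb{R}$, $$H_{K_\varepsilon}[\phi_E](x)=\int_{\mathbb{R}^n}\operatorname{sign}(\phi_E(x)-\phi_E(y))K_\varepsilon(x-y)\,dy,\qquad \tilde H_K[\phi_E](x)=\limsup_{\varepsilon\downarrow0}H_{K_\varepsilon}[\phi_E](x)\in[-\infty,+\infty].$$ *)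

theory Defs
  imports "HOL-Analysis.Analysis"
begin

text \<open>``Measurable'' and ``a.e.'' refer to Lebesgue measurability and Lebesgue measure on the
  completed sigma-algebra, so all integrals are taken over \<open>lebesgue\<close>, not \<open>lborel\<close>.\<close>

definition nl_interaction ::
    "('a::euclidean_space \<Rightarrow> real) \<Rightarrow> 'a set \<Rightarrow> 'a set \<Rightarrow> ennreal" where
  "nl_interaction K A B =
     (\<integral>\<^sup>+x\<in>A. (\<integral>\<^sup>+y\<in>B. ennreal (K (x - y)) \<partial>lebesgue) \<partial>lebesgue)"

definition nl_perimeter ::
    "('a::euclidean_space \<Rightarrow> real) \<Rightarrow> 'a set \<Rightarrow> 'a set \<Rightarrow> ennreal" where
  "nl_perimeter K \<Omega> E =
     nl_interaction K (E \<inter> \<Omega>) (- E \<inter> \<Omega>)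
     + nl_interaction K (E \<inter> \<Omega>) (- E \<inter> - \<Omega>)
     + nl_interaction K (- E \<inter> \<Omega>) (E \<inter> - \<Omega>)"

definition ereal_sign :: "ereal \<Rightarrow> real" where
  "ereal_sign t = (if t < 0 then -1 else if t = 0 then 0 else 1)"

definition truncated_kernel ::
    "('a::euclidean_space \<Rightarrow> real) \<Rightarrow> real \<Rightarrow> 'a \<Rightarrow> real" where
  "truncated_kernel K \<epsilon> z = (if z \<in> - ball 0 \<epsilon> then K z else 0)"

text \<open>Meaningful only where \<open>\<phi> x\<close> is finite: \<open>\<infinity> - \<infinity>\<close> has a junk value in \<^typ>\<open>ereal\<close>.\<close>

definition nl_curvature ::
    "('a::euclidean_space \<Rightarrow> real) \<Rightarrow> ('a \<Rightarrow> ereal) \<Rightarrow> 'a \<Rightarrow> real" where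
  "nl_curvature K \<phi> x = (LINT y|lebesgue. ereal_sign (\<phi> x - \<phi> y) * K (x - y))"

definition upper_nl_curvature ::
    "('a::euclidean_space \<Rightarrow> real) \<Rightarrow> ('a \<Rightarrow> ereal) \<Rightarrow> 'a \<Rightarrow> ereal" where
  "upper_nl_curvature K \<phi> x =
     Limsup (at_right 0) (\<lambda>\<epsilon>. ereal (nl_curvature (truncated_kernel K \<epsilon>) \<phi> x))"

definition level_function ::
    "'a set \<Rightarrow> 'a set \<Rightarrow> ('a \<Rightarrow> real) \<Rightarrow> 'a \<Rightarrow> ereal" where
  "level_function F E \<phi> x =
     (if x \<in> F then \<infinity> else if x \<in> E then ereal (\<phi> x) else -\<infinity>)"

text \<open>The Lebesgue integral of an extended-real function as integral of the positive part minus
  integral of the negative part (\<^const>\<open>e2ennreal\<close> sends negative values to 0). If the integral of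
  the positive part is infinite the value is \<open>\<infinity>\<close>, also when the negative part is infinite; hence
  a value below \<open>\<infinity>\<close> is never an undefined \<open>\<infinity> - \<infinity>\<close>.\<close>

definition ereal_integral :: "'a measure \<Rightarrow> ('a \<Rightarrow> ereal) \<Rightarrow> ereal" where
  "ereal_integral M f =
     enn2ereal (\<integral>\<^sup>+x. e2ennreal (f x) \<partial>M) - enn2ereal (\<integral>\<^sup>+x. e2ennreal (- f x) \<partial>M)"

end

theory Submission
  imports Defs
begin

text \<open>For an integrable even kernel, enlarging \<open>F\<close> to \<open>E\<close> changes the perimeter by the interaction of
  \<open>G = E - F\<close> with \<open>- E\<close> minus its interaction with \<open>F\<close>. Both are read off from the curvature \<open>H\<close> of
  the level function: integrated over \<open>G\<close>, the part of the curvature that comes from \<open>G\<close> itself vanishes, because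
  \<open>sign (\<phi> x - \<phi> y) K (x - y)\<close> is antisymmetric. Hence \<open>P(E) = P(F) + \<integral>\<^sub>G H\<close>.

  The truncated kernels are integrable, so this holds for each of them
  (\<open>nl_perimeter_curvature_balance\<close>). As the truncation parameter runs through a sequence decreasing
  to \<open>0\<close>, the perimeters increase to the perimeters for \<open>K\<close> (\<open>nl_perimeter_SUP_kernel\<close>). The curvatures
  are bounded above by a constant almost everywhere on \<open>G\<close>, which has finite measure, so the reverse Fatou lemma bounds
  the upper limit of their integrals by the integral of their upper limit \<open>g\<close>. All of this is done
  with nonnegative integrals, in the form \<open>P(E) + \<integral>(c - H) = P(F) + c |G|\<close>.

  The upper limit over all truncation parameters is at least \<open>g\<close>. It need not be shown to be
  measurable: the nonnegative integral is monotone for arbitrary functions, and additivity is only used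
  for \<open>g\<close>, which is measurable as the upper limit of a sequence of measurable functions.

  The double integrals are over completed measures; measurability and Tonelli's theorem for functions
  of \<open>(x, y)\<close> such as \<open>K (x - y)\<close> rest on the fact that subtraction and the projections pull null sets
  back to null sets.\<close>

section \<open>Lebesgue measurability and integration on product spaces\<close>

lemma lborel_reflect:
  fixes x :: "'a::euclidean_space"
  shows "distr lborel borel (\<lambda>y. x - y) = lborel"
  by (subst lborel_affine[of "-1" x], auto simp: density_1 distr_distr o_def one_ennreal_def[symmetric])

lemma nn_integral_lborel_reflect:
  fixes x :: "'a::euclidean_space"
  assumes "f \<in> borel_measurable borel"
  shows "(\<integral>\<^sup>+y. f (x - y) \<partial>lborel) = (\<integral>\<^sup>+y. f y \<partial>lborel)"
proof -
  have "(\<integral>\<^sup>+y. f y \<partial>lborel) = (\<integral>\<^sup>+y. f y \<partial>distr lborel borel (\<lambda>y. x - y))"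
    by (simp add: lborel_reflect)
  also have "\<dots> = (\<integral>\<^sup>+y. f (x - y) \<partial>lborel)"
    using assms by (subst nn_integral_distr) auto
  finally show ?thesis by simp
qed

text \<open>Borel measurability alone does not make a composition with a Lebesgue measurable function
  Lebesgue measurable; it suffices that preimages of null sets are null.\<close>

lemma measurable_lebesgue_nonsingular:
  fixes T :: "'a::euclidean_space \<Rightarrow> 'b::euclidean_space"
  assumes T: "T \<in> borel_measurable borel"
    and null: "\<And>N. N \<in> null_sets lborel \<Longrightarrow> T -` N \<in> null_sets lborel"
  shows "T \<in> lebesgue \<rightarrow>\<^sub>M lebesgue"
proof (rule completion.measurable_completion2)
  show T': "T \<in> lebesgue \<rightarrow>\<^sub>M lborel"
    using T by (intro measurable_completion) simp
  show "null_sets lborel \<subseteq> null_sets (distr lebesgue lborel T)"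
  proof
    fix N :: "'b set"
    assume N: "N \<in> null_sets lborel"
    then have "emeasure lebesgue (T -` N) = 0"
      using null[OF N] by (metis null_setsD1 null_sets_completionI)
    with N T' show "N \<in> null_sets (distr lebesgue lborel T)"
      by (auto simp: null_sets_def emeasure_distr)
  qed
qed

lemma measurable_lebesgue_reflect:
  fixes x :: "'a::euclidean_space"
  shows "(\<lambda>y. x - y) \<in> lebesgue \<rightarrow>\<^sub>M lebesgue"
proof (rule measurable_lebesgue_nonsingular)
  fix N :: "'a set" assume N: "N \<in> null_sets lborel"
  then have "N \<in> null_sets (distr lborel borel (\<lambda>y. x - y))"
    by (simp add: lborel_reflect)
  then show "(\<lambda>y. x - y) -` N \<in> null_sets lborel"
    by (subst (asm) null_sets_distr_iff) auto
qed simp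

lemma nn_integral_lebesgue_reflect:
  fixes x :: "'a::euclidean_space"
  assumes f: "f \<in> borel_measurable lebesgue"
  shows "(\<integral>\<^sup>+y. f (x - y) \<partial>lebesgue) = (\<integral>\<^sup>+y. f y \<partial>lebesgue)"
proof -
  obtain g where g: "g \<in> borel_measurable borel" and fg: "AE y in lborel. f y = g y"
    using completion_ex_borel_measurable[OF f] by auto
  have "AE y in distr lborel borel (\<lambda>y. x - y). f y = g y"
    using fg unfolding lborel_reflect .
  then have "AE y in lborel. f (x - y) = g (x - y)"
    by (rule AE_distrD[rotated]) simp
  then have "(\<integral>\<^sup>+y. f (x - y) \<partial>lebesgue) = (\<integral>\<^sup>+y. g (x - y) \<partial>lborel)"
    unfolding nn_integral_completion by (rule nn_integral_cong_AE)
  also have "\<dots> = (\<integral>\<^sup>+y. g y \<partial>lborel)"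
    by (rule nn_integral_lborel_reflect[OF g])
  also have "\<dots> = (\<integral>\<^sup>+y. f y \<partial>lebesgue)"
    unfolding nn_integral_completion using fg by (intro nn_integral_cong_AE) auto
  finally show ?thesis .
qed

lemma measurable_lebesgue_fst:
  "fst \<in> (lebesgue :: ('a::euclidean_space \<times> 'b::euclidean_space) measure) \<rightarrow>\<^sub>M lebesgue"
proof (rule measurable_lebesgue_nonsingular)
  fix N :: "'a set" assume N: "N \<in> null_sets lborel"
  have "N \<times> (UNIV :: 'b set) \<in> null_sets (lborel \<Otimes>\<^sub>M lborel)"
    using N by (auto simp: null_sets_def lborel.emeasure_pair_measure_Times)
  moreover have "fst -` N = N \<times> (UNIV :: 'b set)" by auto
  ultimately show "fst -` N \<in> null_sets (lborel :: ('a \<times> 'b) measure)"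
    by (simp add: lborel_prod)
qed (simp flip: borel_prod)

lemma measurable_lebesgue_snd:
  "snd \<in> (lebesgue :: ('a::euclidean_space \<times> 'b::euclidean_space) measure) \<rightarrow>\<^sub>M lebesgue"
proof (rule measurable_lebesgue_nonsingular)
  fix N :: "'b set" assume N: "N \<in> null_sets lborel"
  have "(UNIV :: 'a set) \<times> N \<in> null_sets (lborel \<Otimes>\<^sub>M lborel)"
    using N by (auto simp: null_sets_def lborel.emeasure_pair_measure_Times)
  moreover have "snd -` N = (UNIV :: 'a set) \<times> N" by auto
  ultimately show "snd -` N \<in> null_sets (lborel :: ('a \<times> 'b) measure)"
    by (simp add: lborel_prod)
qed (simp flip: borel_prod)

lemma measurable_lebesgue_diff:
  "(\<lambda>z. fst z - snd z) \<in> (lebesgue :: ('a::euclidean_space \<times> 'a) measure) \<rightarrow>\<^sub>M lebesgue"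
proof (rule measurable_lebesgue_nonsingular)
  show T: "(\<lambda>z. fst z - snd z) \<in> borel_measurable (borel :: ('a \<times> 'a) measure)"
    by (simp flip: borel_prod)
  fix N :: "'a set" assume N: "N \<in> null_sets lborel"
  let ?T = "(\<lambda>z. fst z - snd z) -` N"
  have [measurable]: "N \<in> sets borel" using N by auto
  have T': "?T \<in> sets (borel :: ('a \<times> 'a) measure)"
    using measurable_sets[OF T, of N] by simp
  then have T2: "?T \<in> sets (lborel \<Otimes>\<^sub>M lborel)"
    by (simp only: lborel_prod sets_lborel)
  then have "emeasure (lborel \<Otimes>\<^sub>M lborel) ?T = (\<integral>\<^sup>+x. emeasure lborel (Pair x -` ?T) \<partial>lborel)"
    by (rule lborel.emeasure_pair_measure_alt)
  also have "\<dots> = (\<integral>\<^sup>+x. \<integral>\<^sup>+y. indicator N (x - y) \<partial>lborel \<partial>(lborel::'a measure))"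
  proof (rule nn_integral_cong)
    fix x :: 'a
    have "Pair x -` ?T \<in> sets lborel" using T2 by (rule sets_Pair1)
    then have "emeasure lborel (Pair x -` ?T) = (\<integral>\<^sup>+y. indicator (Pair x -` ?T) y \<partial>lborel)" by simp
    also have "\<dots> = (\<integral>\<^sup>+y. indicator N (x - y) \<partial>lborel)"
      by (intro nn_integral_cong) (auto simp: indicator_def)
    finally show "emeasure lborel (Pair x -` ?T) = \<dots>" .
  qed
  also have "\<dots> = (\<integral>\<^sup>+x. \<integral>\<^sup>+y. indicator N y \<partial>lborel \<partial>(lborel::'a measure))"
    by (subst nn_integral_lborel_reflect[of "indicator N"]) simp_all
  also have "\<dots> = 0" using N by (simp add: null_sets_def)
  finally show "?T \<in> null_sets lborel"
    using T' by (auto simp: lborel_prod null_sets_def)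
qed

lemma borel_measurable_lebesgue_cong_AE:
  assumes g: "g \<in> borel_measurable lebesgue" and eq: "AE x in lborel. f x = g x"
  shows "f \<in> borel_measurable lebesgue"
proof (rule borel_measurableI)
  fix S :: "'b set" assume "open S"
  have m: "{x. g x \<in> S} \<in> sets lebesgue"
    using measurable_sets[OF g, of S] \<open>open S\<close> by (simp add: vimage_def)
  have ae: "AE x in lebesgue. x \<in> {x. g x \<in> S} \<longleftrightarrow> x \<in> {x. f x \<in> S}"
    using AE_completion[OF eq] by eventually_elim simp
  have "{x. f x \<in> S} \<in> sets lebesgue"
    by (rule completion.in_sets_AE[OF ae m]) auto
  then show "f -` S \<inter> space lebesgue \<in> sets lebesgue" by (simp add: vimage_def)
qed

text \<open>Tonelli's theorem for the completed measures. The product of the completions is not complete,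
  so the hypothesis is measurability with respect to Lebesgue measure on the product space; the
  proof replaces \<open>h\<close> by a Borel function that agrees with it almost everywhere.\<close>

lemma
  fixes h :: "'a::euclidean_space \<times> 'b::euclidean_space \<Rightarrow> ennreal"
  assumes h: "h \<in> borel_measurable lebesgue"
  shows borel_measurable_nn_integral_lebesgue_fst:
      "(\<lambda>x. \<integral>\<^sup>+y. h (x, y) \<partial>lebesgue) \<in> borel_measurable lebesgue"
    and nn_integral_lebesgue_fst:
      "(\<integral>\<^sup>+x. \<integral>\<^sup>+y. h (x, y) \<partial>lebesgue \<partial>lebesgue) = (\<integral>\<^sup>+z. h z \<partial>lebesgue)"
    and nn_integral_lebesgue_snd:
      "(\<integral>\<^sup>+y. \<integral>\<^sup>+x. h (x, y) \<partial>lebesgue \<partial>lebesgue) = (\<integral>\<^sup>+z. h z \<partial>lebesgue)"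
proof -
  obtain g where g: "g \<in> borel_measurable borel" and hg: "AE z in lborel. h z = g z"
    using completion_ex_borel_measurable[OF h] by auto
  have g': "g \<in> borel_measurable (lborel \<Otimes>\<^sub>M lborel)"
    using g by (simp add: lborel_prod)
  have ae: "AE z in lborel \<Otimes>\<^sub>M lborel. h z = g z"
    using hg unfolding lborel_prod .
  have fstae: "AE x in lborel. AE y in lborel. h (x, y) = g (x, y)"
    using lborel_pair.AE_pair[OF ae] by simp
  have "AE z in distr (lborel \<Otimes>\<^sub>M lborel) (lborel \<Otimes>\<^sub>M lborel) (\<lambda>(x, y). (y, x)). h z = g z"
    using ae by (subst lborel_pair.distr_pair_swap[symmetric])
  then have "AE z in lborel \<Otimes>\<^sub>M lborel. h (snd z, fst z) = g (snd z, fst z)"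
    by (rule AE_distrD[rotated, THEN AE_mp]) (auto simp: split_beta)
  from lborel_pair.AE_pair[OF this]
  have sndae: "AE y in lborel. AE x in lborel. h (x, y) = g (x, y)" by simp
  have inner: "AE x in lborel. (\<integral>\<^sup>+y. h (x, y) \<partial>lebesgue) = (\<integral>\<^sup>+y. g (x, y) \<partial>lborel)"
    using fstae by eventually_elim (simp add: nn_integral_completion nn_integral_cong_AE)
  have inner': "AE y in lborel. (\<integral>\<^sup>+x. h (x, y) \<partial>lebesgue) = (\<integral>\<^sup>+x. g (x, y) \<partial>lborel)"
    using sndae by eventually_elim (simp add: nn_integral_completion nn_integral_cong_AE)
  have tot: "(\<integral>\<^sup>+z. h z \<partial>lebesgue) = (\<integral>\<^sup>+z. g z \<partial>(lborel \<Otimes>\<^sub>M lborel))"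
    unfolding nn_integral_completion lborel_prod using hg by (rule nn_integral_cong_AE)
  have mg: "(\<lambda>x. \<integral>\<^sup>+y. g (x, y) \<partial>lborel) \<in> borel_measurable lebesgue"
    using lborel.borel_measurable_nn_integral_fst[OF g'] by (intro measurable_completion) simp
  show "(\<lambda>x. \<integral>\<^sup>+y. h (x, y) \<partial>lebesgue) \<in> borel_measurable lebesgue"
    by (rule borel_measurable_lebesgue_cong_AE[OF mg inner])
  show "(\<integral>\<^sup>+x. \<integral>\<^sup>+y. h (x, y) \<partial>lebesgue \<partial>lebesgue) = (\<integral>\<^sup>+z. h z \<partial>lebesgue)"
    unfolding tot lborel.nn_integral_fst[OF g', symmetric]
    by (subst nn_integral_completion) (rule nn_integral_cong_AE[OF inner])
  show "(\<integral>\<^sup>+y. \<integral>\<^sup>+x. h (x, y) \<partial>lebesgue \<partial>lebesgue) = (\<integral>\<^sup>+z. h z \<partial>lebesgue)"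
    unfolding tot lborel_pair.nn_integral_snd[OF g', symmetric]
    by (subst nn_integral_completion) (rule nn_integral_cong_AE[OF inner'])
qed

section \<open>Interactions as masses of sets of pairs\<close>

lemma borel_measurable_lebesgue_kernel:
  fixes K :: "'a::euclidean_space \<Rightarrow> real"
  assumes "K \<in> borel_measurable lebesgue"
  shows "(\<lambda>z. ennreal (K (fst z - snd z))) \<in> borel_measurable lebesgue"
  using measurable_compose[OF measurable_lebesgue_diff assms] by simp

lemma borel_measurable_lebesgue_kernel_section:
  fixes K :: "'a::euclidean_space \<Rightarrow> real"
  assumes "K \<in> borel_measurable lebesgue"
  shows "(\<lambda>y. K (x - y)) \<in> borel_measurable lebesgue"
  using measurable_compose[OF measurable_lebesgue_reflect assms] .

lemma sets_lebesgue_Times: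
  fixes A :: "'a::euclidean_space set" and B :: "'b::euclidean_space set"
  assumes "A \<in> sets lebesgue" "B \<in> sets lebesgue"
  shows "A \<times> B \<in> sets lebesgue"
proof -
  have "A \<times> B = (fst -` A \<inter> space lebesgue) \<inter> (snd -` B \<inter> space lebesgue)" by auto
  then show ?thesis
    using measurable_sets[OF measurable_lebesgue_fst assms(1)]
      measurable_sets[OF measurable_lebesgue_snd assms(2)] by auto
qed

text \<open>The mass of a set \<open>D\<close> of pairs under the measure with density \<open>K (x - y)\<close>. A product set
  \<open>A \<times> B\<close> has mass \<open>nl_interaction K A B\<close>, but sets such as \<open>{(x, y). u y < u x}\<close> are allowed too.\<close>

definition pair_interaction ::
    "('a::euclidean_space \<Rightarrow> real) \<Rightarrow> ('a \<times> 'a) set \<Rightarrow> ennreal" where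
  "pair_interaction K D = (\<integral>\<^sup>+z\<in>D. ennreal (K (fst z - snd z)) \<partial>lebesgue)"

lemma
  fixes K :: "'a::euclidean_space \<Rightarrow> real"
  assumes K: "K \<in> borel_measurable lebesgue" and D: "D \<in> sets lebesgue"
  shows borel_measurable_pair_interaction_section:
      "(\<lambda>x. \<integral>\<^sup>+y\<in>{y. (x, y) \<in> D}. ennreal (K (x - y)) \<partial>lebesgue) \<in> borel_measurable lebesgue"
    and pair_interaction_iterated:
      "(\<integral>\<^sup>+x. (\<integral>\<^sup>+y\<in>{y. (x, y) \<in> D}. ennreal (K (x - y)) \<partial>lebesgue) \<partial>lebesgue) = pair_interaction K D"
    and pair_interaction_iterated':
      "(\<integral>\<^sup>+y. (\<integral>\<^sup>+x\<in>{x. (x, y) \<in> D}. ennreal (K (x - y)) \<partial>lebesgue) \<partial>lebesgue) = pair_interaction K D"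
proof -
  let ?h = "\<lambda>z. ennreal (K (fst z - snd z)) * indicator D z"
  have h: "?h \<in> borel_measurable lebesgue"
    using borel_measurable_lebesgue_kernel[OF K] D by measurable
  have i1: "indicator D (x, y) = (indicator {y. (x, y) \<in> D} y :: ennreal)"
    and i2: "indicator D (x, y) = (indicator {x. (x, y) \<in> D} x :: ennreal)" for x y
    by (auto simp: indicator_def)
  show "(\<lambda>x. \<integral>\<^sup>+y\<in>{y. (x, y) \<in> D}. ennreal (K (x - y)) \<partial>lebesgue) \<in> borel_measurable lebesgue"
    using borel_measurable_nn_integral_lebesgue_fst[OF h] by (simp add: i1)
  show "(\<integral>\<^sup>+x. (\<integral>\<^sup>+y\<in>{y. (x, y) \<in> D}. ennreal (K (x - y)) \<partial>lebesgue) \<partial>lebesgue) = pair_interaction K D"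
    using nn_integral_lebesgue_fst[OF h] by (simp add: i1 pair_interaction_def)
  show "(\<integral>\<^sup>+y. (\<integral>\<^sup>+x\<in>{x. (x, y) \<in> D}. ennreal (K (x - y)) \<partial>lebesgue) \<partial>lebesgue) = pair_interaction K D"
    using nn_integral_lebesgue_snd[OF h] by (simp add: i2 pair_interaction_def)
qed

lemma nn_integral_section_eq_pair_interaction:
  fixes K :: "'a::euclidean_space \<Rightarrow> real"
  assumes K: "K \<in> borel_measurable lebesgue" and D: "{z. fst z \<in> A \<and> P (fst z) (snd z)} \<in> sets lebesgue"
  shows "(\<integral>\<^sup>+x\<in>A. (\<integral>\<^sup>+y\<in>{y. P x y}. ennreal (K (x - y)) \<partial>lebesgue) \<partial>lebesgue)
    = pair_interaction K {z. fst z \<in> A \<and> P (fst z) (snd z)}"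
  unfolding pair_interaction_iterated[OF K D, symmetric]
  by (intro nn_integral_cong) (auto simp: indicator_def)

lemma nl_interaction_eq_pair_interaction:
  fixes K :: "'a::euclidean_space \<Rightarrow> real"
  assumes K: "K \<in> borel_measurable lebesgue" and A: "A \<in> sets lebesgue" and B: "B \<in> sets lebesgue"
  shows "nl_interaction K A B = pair_interaction K (A \<times> B)"
  unfolding nl_interaction_def pair_interaction_iterated[OF K sets_lebesgue_Times[OF A B], symmetric]
  by (intro nn_integral_cong) (auto simp: indicator_def)

lemma pair_interaction_Un:
  fixes K :: "'a::euclidean_space \<Rightarrow> real"
  assumes K: "K \<in> borel_measurable lebesgue" and D: "D \<in> sets lebesgue" "D' \<in> sets lebesgue"
    and "D \<inter> D' = {}"
  shows "pair_interaction K (D \<union> D') = pair_interaction K D + pair_interaction K D'"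
proof -
  note [measurable] = borel_measurable_lebesgue_kernel[OF K] D
  have "pair_interaction K (D \<union> D') = (\<integral>\<^sup>+z. ennreal (K (fst z - snd z)) * indicator D z
      + ennreal (K (fst z - snd z)) * indicator D' z \<partial>lebesgue)"
    unfolding pair_interaction_def using \<open>D \<inter> D' = {}\<close>
    by (intro nn_integral_cong) (auto simp: indicator_def)
  also have "\<dots> = pair_interaction K D + pair_interaction K D'"
    unfolding pair_interaction_def by (rule nn_integral_add) measurable
  finally show ?thesis .
qed

lemma pair_interaction_swap:
  fixes D :: "('a::euclidean_space \<times> 'a) set"
  assumes K: "K \<in> borel_measurable lebesgue" and even: "\<And>z. K (- z) = K z"
    and D: "D \<in> sets lebesgue" and S: "prod.swap -` D \<in> sets lebesgue"
  shows "pair_interaction K (prod.swap -` D) = pair_interaction K D"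
proof -
  have "K (y - x) = K (x - y)" for x y using even[of "x - y"] by simp
  then show ?thesis
    unfolding pair_interaction_iterated[OF K S, symmetric] pair_interaction_iterated'[OF K D, symmetric]
    by simp
qed

lemma nl_interaction_commute:
  fixes K :: "'a::euclidean_space \<Rightarrow> real"
  assumes K: "K \<in> borel_measurable lebesgue" and even: "\<And>z. K (- z) = K z"
    and A: "A \<in> sets lebesgue" and B: "B \<in> sets lebesgue"
  shows "nl_interaction K A B = nl_interaction K B A"
proof -
  have [simp]: "prod.swap -` (A \<times> B) = B \<times> A" by auto
  show ?thesis
    using pair_interaction_swap[OF K even, of "A \<times> B"] A B
    by (simp add: nl_interaction_eq_pair_interaction[OF K] sets_lebesgue_Times)
qed

lemma
  fixes K :: "'a::euclidean_space \<Rightarrow> real"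
  assumes K: "K \<in> borel_measurable lebesgue"
    and A: "A \<in> sets lebesgue" and B: "B \<in> sets lebesgue" and C: "C \<in> sets lebesgue"
    and "A \<inter> B = {}"
  shows nl_interaction_Un_left:
      "nl_interaction K (A \<union> B) C = nl_interaction K A C + nl_interaction K B C"
    and nl_interaction_Un_right:
      "nl_interaction K C (A \<union> B) = nl_interaction K C A + nl_interaction K C B"
  using pair_interaction_Un[OF K, of "A \<times> C" "B \<times> C"] pair_interaction_Un[OF K, of "C \<times> A" "C \<times> B"] assms
  by (auto simp: nl_interaction_eq_pair_interaction sets_lebesgue_Times Sigma_Un_distrib1 Sigma_Un_distrib2)

text \<open>Moving \<open>E - F\<close> from the complement to the set removes its interaction with \<open>F\<close> from the
  perimeter and adds its interaction with \<open>- E\<close>. The identity is stated without subtraction, so that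
  it holds for infinite values as well.\<close>

lemma nl_perimeter_exchange:
  fixes K :: "'a::euclidean_space \<Rightarrow> real"
  assumes K: "K \<in> borel_measurable lebesgue" and even: "\<And>z. K (- z) = K z"
    and \<Omega>: "\<Omega> \<in> sets lebesgue" and F: "F \<in> sets lebesgue" and E: "E \<in> sets lebesgue"
    and FE: "F \<subseteq> E" "F - \<Omega> = E - \<Omega>"
  shows "nl_perimeter K \<Omega> E + nl_interaction K (E - F) F
    = nl_perimeter K \<Omega> F + nl_interaction K (E - F) (- E)"
proof -
  define A B a b G where "A = F \<inter> \<Omega>" and "B = - E \<inter> \<Omega>" and "a = F \<inter> - \<Omega>"
    and "b = - E \<inter> - \<Omega>" and "G = E - F"
  have m[simp]: "A \<in> sets lebesgue" "B \<in> sets lebesgue" "a \<in> sets lebesgue" "b \<in> sets lebesgue"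
      "G \<in> sets lebesgue"
    using E F \<Omega> by (auto simp: A_def B_def a_def b_def G_def Compl_in_sets_lebesgue)
  have d[simp]: "A \<inter> G = {}" "B \<inter> G = {}" "A \<inter> a = {}" "B \<inter> b = {}"
    by (auto simp: A_def B_def a_def b_def G_def)
  have s: "E \<inter> \<Omega> = A \<union> G" "- F \<inter> \<Omega> = B \<union> G" "E \<inter> - \<Omega> = a" "- F \<inter> - \<Omega> = b"
      "F \<inter> \<Omega> = A" "- E \<inter> \<Omega> = B" "F \<inter> - \<Omega> = a" "- E \<inter> - \<Omega> = b" "E - F = G"
    using FE by (auto simp: A_def B_def a_def b_def G_def)
  have s': "F = A \<union> a" "- E = B \<union> b"
    by (auto simp: A_def B_def a_def b_def)
  let ?L = "nl_interaction K"
  have "nl_perimeter K \<Omega> E + ?L G F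
      = (?L A B + ?L G B + (?L A b + ?L G b) + ?L B a) + (?L G A + ?L G a)"
    unfolding nl_perimeter_def s by (subst s'(1)) (simp add: nl_interaction_Un_left[OF K] nl_interaction_Un_right[OF K])
  also have "\<dots> = (?L A B + ?L A G + ?L A b + (?L B a + ?L G a)) + (?L G B + ?L G b)"
    unfolding nl_interaction_commute[OF K even m(1) m(5)] by (simp add: ac_simps)
  also have "\<dots> = nl_perimeter K \<Omega> F + ?L G (- E)"
    unfolding nl_perimeter_def s by (subst s'(2)) (simp add: nl_interaction_Un_left[OF K] nl_interaction_Un_right[OF K])
  finally show ?thesis unfolding G_def .
qed

section \<open>Truncated kernels\<close>

lemma borel_measurable_truncated_kernel:
  assumes "K \<in> borel_measurable lebesgue"
  shows "truncated_kernel K \<epsilon> \<in> borel_measurable lebesgue"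
proof -
  have "- ball 0 \<epsilon> \<in> sets lebesgue" by (simp add: Compl_in_sets_lebesgue)
  with assms show ?thesis
    unfolding truncated_kernel_def[abs_def] by (intro measurable_If_set) auto
qed

lemma nn_integral_truncated_kernel_finite:
  fixes K :: "'a::euclidean_space \<Rightarrow> real"
  assumes K: "K \<in> borel_measurable lebesgue" and nonneg: "\<And>z. K z \<ge> 0"
    and fin: "(\<integral>\<^sup>+z. ennreal (min 1 (norm z) * K z) \<partial>lebesgue) < \<infinity>" and "\<epsilon> > 0"
  shows "(\<integral>\<^sup>+z. ennreal (truncated_kernel K \<epsilon> z) \<partial>lebesgue) < \<infinity>"
proof -
  let ?c = "inverse (min 1 \<epsilon>)"
  have "truncated_kernel K \<epsilon> z \<le> ?c * (min 1 (norm z) * K z)" for z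
  proof (cases "norm z < \<epsilon>")
    case False
    then have "min 1 \<epsilon> * K z \<le> min 1 (norm z) * K z"
      using nonneg[of z] by (intro mult_right_mono) auto
    then have "?c * (min 1 \<epsilon> * K z) \<le> ?c * (min 1 (norm z) * K z)"
      using \<open>\<epsilon> > 0\<close> by (intro mult_left_mono) auto
    moreover have "?c * (min 1 \<epsilon> * K z) = K z"
      using \<open>\<epsilon> > 0\<close> by (simp add: min_def)
    ultimately show ?thesis using False by (simp add: truncated_kernel_def)
  qed (use nonneg[of z] \<open>\<epsilon> > 0\<close> in \<open>simp add: truncated_kernel_def\<close>)
  then have "(\<integral>\<^sup>+z. ennreal (truncated_kernel K \<epsilon> z) \<partial>lebesgue)
      \<le> (\<integral>\<^sup>+z. ennreal ?c * ennreal (min 1 (norm z) * K z) \<partial>lebesgue)"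
    using \<open>\<epsilon> > 0\<close> nonneg by (intro nn_integral_mono) (simp add: ennreal_leI flip: ennreal_mult)
  also have "\<dots> = ennreal ?c * (\<integral>\<^sup>+z. ennreal (min 1 (norm z) * K z) \<partial>lebesgue)"
  proof (rule nn_integral_cmult)
    have "(\<lambda>z::'a. min 1 (norm z)) \<in> borel_measurable lebesgue"
      by (intro measurable_completion) simp
    with K show "(\<lambda>z. ennreal (min 1 (norm z) * K z)) \<in> borel_measurable lebesgue" by simp
  qed
  also have "\<dots> < \<infinity>" using fin by (simp add: ennreal_mult_less_top)
  finally show ?thesis .
qed

lemma
  assumes "\<And>z. K z \<ge> 0"
  shows truncated_kernel_nonneg: "truncated_kernel K \<epsilon> z \<ge> 0"
    and truncated_kernel_le: "truncated_kernel K \<epsilon> z \<le> K z"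
    and truncated_kernel_antimono: "\<epsilon> \<le> \<delta> \<Longrightarrow> truncated_kernel K \<delta> z \<le> truncated_kernel K \<epsilon> z"
  using assms by (auto simp: truncated_kernel_def)

lemma truncated_kernel_even:
  "(\<And>z. K (- z) = K z) \<Longrightarrow> truncated_kernel K \<epsilon> (- z) = truncated_kernel K \<epsilon> z"
  by (simp add: truncated_kernel_def)

lemma nl_perimeter_mono_kernel:
  assumes "\<And>z. K z \<le> K' z"
  shows "nl_perimeter K \<Omega> E \<le> nl_perimeter K' \<Omega> E"
  unfolding nl_perimeter_def nl_interaction_def
  by (intro add_mono nn_integral_mono mult_right_mono ennreal_leI assms) auto

text \<open>Convergence of the kernels is not needed at \<open>0\<close>: the truncated kernels vanish there, whatever
  the value of \<open>K 0\<close> is.\<close>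

lemma nl_interaction_SUP_kernel:
  fixes K :: "'a::euclidean_space \<Rightarrow> real"
  assumes Kn: "\<And>n. Kn n \<in> borel_measurable lebesgue"
    and inc: "\<And>m n z. m \<le> n \<Longrightarrow> Kn m z \<le> Kn n z"
    and lim: "\<And>z. z \<noteq> 0 \<Longrightarrow> (SUP n::nat. ennreal (Kn n z)) = ennreal (K z)"
    and A: "A \<in> sets lebesgue" and B: "B \<in> sets lebesgue"
  shows "nl_interaction K A B = (SUP n. nl_interaction (Kn n) A B)"
proof -
  let ?I = "\<lambda>n x. (\<integral>\<^sup>+y\<in>B. ennreal (Kn n (x - y)) \<partial>lebesgue) * indicator A x"
  have inner: "(\<integral>\<^sup>+y\<in>B. ennreal (K (x - y)) \<partial>lebesgue) = (SUP n. \<integral>\<^sup>+y\<in>B. ennreal (Kn n (x - y)) \<partial>lebesgue)"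
    for x
  proof -
    have "AE y in lborel. y \<noteq> x"
      by (rule AE_lborel_singleton)
    from AE_completion[OF this]
    have "AE y in lebesgue. ennreal (K (x - y)) * indicator B y
        = (SUP n. ennreal (Kn n (x - y)) * indicator B y)"
      by eventually_elim (simp add: lim split: split_indicator)
    then have "(\<integral>\<^sup>+y\<in>B. ennreal (K (x - y)) \<partial>lebesgue)
        = (\<integral>\<^sup>+y. (SUP n. ennreal (Kn n (x - y)) * indicator B y) \<partial>lebesgue)"
      by (rule nn_integral_cong_AE)
    also have "\<dots> = (SUP n. \<integral>\<^sup>+y\<in>B. ennreal (Kn n (x - y)) \<partial>lebesgue)"
    proof (rule nn_integral_monotone_convergence_SUP)
      show "incseq (\<lambda>n y. ennreal (Kn n (x - y)) * indicator B y)"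
        by (intro incseq_SucI le_funI mult_right_mono ennreal_leI inc) auto
      show "(\<lambda>y. ennreal (Kn n (x - y)) * indicator B y) \<in> borel_measurable lebesgue" for n
        using borel_measurable_lebesgue_kernel_section[OF Kn] B by measurable
    qed
    finally show ?thesis .
  qed
  have "nl_interaction K A B = (\<integral>\<^sup>+x. (SUP n. ?I n x) \<partial>lebesgue)"
    unfolding nl_interaction_def by (simp add: inner SUP_mult_right_ennreal)
  also have "\<dots> = (SUP n. \<integral>\<^sup>+x. ?I n x \<partial>lebesgue)"
  proof (rule nn_integral_monotone_convergence_SUP)
    show "incseq ?I"
      by (intro incseq_SucI le_funI mult_right_mono nn_integral_mono ennreal_leI inc) auto
    have [simp]: "{y. (x, y) \<in> UNIV \<times> B} = B" for x :: 'a by auto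
    show "?I n \<in> borel_measurable lebesgue" for n
      using borel_measurable_pair_interaction_section[OF Kn sets_lebesgue_Times[of UNIV B]] A B by simp
  qed
  finally show ?thesis by (simp add: nl_interaction_def)
qed

lemma incseq_nl_interaction:
  assumes inc: "\<And>m n z. m \<le> n \<Longrightarrow> Kn m z \<le> Kn n z"
  shows "incseq (\<lambda>n::nat. nl_interaction (Kn n) A B)"
  unfolding nl_interaction_def
  by (intro incseq_SucI nn_integral_mono mult_right_mono ennreal_leI inc) auto

lemma nl_perimeter_SUP_kernel:
  fixes K :: "'a::euclidean_space \<Rightarrow> real"
  assumes Kn: "\<And>n. Kn n \<in> borel_measurable lebesgue"
    and inc: "\<And>m n z. m \<le> n \<Longrightarrow> Kn m z \<le> Kn n z"
    and lim: "\<And>z. z \<noteq> 0 \<Longrightarrow> (SUP n::nat. ennreal (Kn n z)) = ennreal (K z)"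
    and \<Omega>: "\<Omega> \<in> sets lebesgue" and E: "E \<in> sets lebesgue"
  shows "nl_perimeter K \<Omega> E = (SUP n. nl_perimeter (Kn n) \<Omega> E)"
proof -
  note s = nl_interaction_SUP_kernel[OF Kn inc lim] and i = incseq_nl_interaction[where Kn=Kn, OF inc]
  have "incseq (\<lambda>n. nl_interaction (Kn n) A B + nl_interaction (Kn n) A' B')" for A B A' B'
    using i[of A B] i[of A' B'] by (auto simp: incseq_def intro: add_mono)
  then show ?thesis
    unfolding nl_perimeter_def using \<Omega> E
    by (simp add: s i ennreal_SUP_add Compl_in_sets_lebesgue)
qed

lemma SUP_truncated_kernel:
  fixes z :: "'a::euclidean_space"
  assumes nonneg: "\<And>z. K z \<ge> 0" and \<epsilon>: "\<epsilon> \<longlonglongrightarrow> 0" and "z \<noteq> 0"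
  shows "(SUP n::nat. ennreal (truncated_kernel K (\<epsilon> n) z)) = ennreal (K z)"
proof (rule antisym)
  show "(SUP n::nat. ennreal (truncated_kernel K (\<epsilon> n) z)) \<le> ennreal (K z)"
    by (intro SUP_least ennreal_leI truncated_kernel_le nonneg)
  have "\<forall>\<^sub>F n in sequentially. \<epsilon> n < norm z"
    using \<epsilon> \<open>z \<noteq> 0\<close> by (intro order_tendstoD) auto
  then obtain n where "\<epsilon> n < norm z" by (auto simp: eventually_sequentially)
  then have "truncated_kernel K (\<epsilon> n) z = K z" by (simp add: truncated_kernel_def)
  then show "ennreal (K z) \<le> (SUP n::nat. ennreal (truncated_kernel K (\<epsilon> n) z))"
    by (metis SUP_upper UNIV_I)
qed

section \<open>Curvature and change of perimeter\<close>

lemma borel_measurable_level_function: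
  fixes \<phi> :: "'a::euclidean_space \<Rightarrow> real"
  assumes F: "F \<in> sets lebesgue" and E: "E \<in> sets lebesgue"
    and \<phi>: "\<phi> \<in> borel_measurable (lebesgue_on (E - F))"
  shows "level_function F E \<phi> \<in> borel_measurable lebesgue"
proof -
  define f where "f x = (if x \<in> E - F then \<phi> x else 0)" for x
  have eq: "level_function F E \<phi> = (\<lambda>x. if x \<in> F then \<infinity> else if x \<in> E then ereal (f x) else -\<infinity>)"
    by (auto simp: level_function_def f_def fun_eq_iff)
  have "f \<in> borel_measurable lebesgue"
    unfolding f_def[abs_def] using F E by (intro borel_measurable_if_I[OF \<phi>]) auto
  then show ?thesis
    unfolding eq using F E by (intro measurable_If_set borel_measurable_ereal) auto
qed

lemma sets_lebesgue_less_pair: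
  fixes u :: "'a::euclidean_space \<Rightarrow> ereal"
  assumes u: "u \<in> borel_measurable lebesgue"
  shows "{z. u (fst z) < u (snd z)} \<in> sets lebesgue" "{z. u (snd z) < u (fst z)} \<in> sets lebesgue"
proof -
  note fst = measurable_compose[OF measurable_lebesgue_fst u]
    and snd = measurable_compose[OF measurable_lebesgue_snd u]
  show "{z. u (fst z) < u (snd z)} \<in> sets lebesgue"
    using borel_measurable_less[OF fst snd] by simp
  show "{z. u (snd z) < u (fst z)} \<in> sets lebesgue"
    using borel_measurable_less[OF snd fst] by simp
qed

lemma
  fixes K :: "'a::euclidean_space \<Rightarrow> real"
  assumes K: "K \<in> borel_measurable lebesgue" and u: "u \<in> borel_measurable lebesgue"
  shows borel_measurable_nn_integral_sublevel:
      "(\<lambda>x. \<integral>\<^sup>+y\<in>{y. u y < (u x :: ereal)}. ennreal (K (x - y)) \<partial>lebesgue) \<in> borel_measurable lebesgue"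
    and borel_measurable_nn_integral_superlevel:
      "(\<lambda>x. \<integral>\<^sup>+y\<in>{y. u x < u y}. ennreal (K (x - y)) \<partial>lebesgue) \<in> borel_measurable lebesgue"
proof -
  show "(\<lambda>x. \<integral>\<^sup>+y\<in>{y. u y < u x}. ennreal (K (x - y)) \<partial>lebesgue) \<in> borel_measurable lebesgue"
    using borel_measurable_pair_interaction_section[OF K sets_lebesgue_less_pair(2)[OF u]] by simp
  show "(\<lambda>x. \<integral>\<^sup>+y\<in>{y. u x < u y}. ennreal (K (x - y)) \<partial>lebesgue) \<in> borel_measurable lebesgue"
    using borel_measurable_pair_interaction_section[OF K sets_lebesgue_less_pair(1)[OF u]] by simp
qed

lemma section_integral_le:
  fixes K :: "'a::euclidean_space \<Rightarrow> real"
  assumes K: "K \<in> borel_measurable lebesgue"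
  shows "(\<integral>\<^sup>+y\<in>S. ennreal (K (x - y)) \<partial>lebesgue) \<le> (\<integral>\<^sup>+z. ennreal (K z) \<partial>lebesgue)"
proof -
  have "(\<integral>\<^sup>+y\<in>S. ennreal (K (x - y)) \<partial>lebesgue) \<le> (\<integral>\<^sup>+y. ennreal (K (x - y)) \<partial>lebesgue)"
    by (intro nn_integral_mono) (simp split: split_indicator)
  also have "\<dots> = (\<integral>\<^sup>+z. ennreal (K z) \<partial>lebesgue)"
    using K by (intro nn_integral_lebesgue_reflect) simp
  finally show ?thesis .
qed

lemma nl_curvature_eq_diff:
  fixes K :: "'a::euclidean_space \<Rightarrow> real" and u :: "'a \<Rightarrow> ereal"
  assumes K: "K \<in> borel_measurable lebesgue" and nonneg: "\<And>z. K z \<ge> 0"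
    and fin: "(\<integral>\<^sup>+z. ennreal (K z) \<partial>lebesgue) < \<infinity>"
    and u: "u \<in> borel_measurable lebesgue" and x: "\<bar>u x\<bar> \<noteq> \<infinity>"
  shows "nl_curvature K u x =
      enn2real (\<integral>\<^sup>+y\<in>{y. u y < u x}. ennreal (K (x - y)) \<partial>lebesgue)
    - enn2real (\<integral>\<^sup>+y\<in>{y. u x < u y}. ennreal (K (x - y)) \<partial>lebesgue)"
proof -
  let ?f = "\<lambda>y. ereal_sign (u x - u y) * K (x - y)"
  have s: "ereal_sign (u x - u y) = (if u y < u x then 1 else if u x < u y then -1 else 0)" for y
    using x by (cases "u x"; cases "u y") (auto simp: ereal_sign_def)
  have pos: "ennreal (?f y) = ennreal (K (x - y)) * indicator {y. u y < u x} y"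
    and neg: "ennreal (- ?f y) = ennreal (K (x - y)) * indicator {y. u x < u y} y" for y
    using nonneg[of "x - y"] by (auto simp: s ennreal_neg)
  have Kx: "(\<lambda>y. K (x - y)) \<in> borel_measurable lebesgue"
    by (rule borel_measurable_lebesgue_kernel_section[OF K])
  have "integrable lebesgue ?f"
  proof (rule Bochner_Integration.integrable_bound)
    show "integrable lebesgue (\<lambda>y. K (x - y))"
      using Kx nonneg fin section_integral_le[OF K, of x UNIV]
      by (intro integrableI_nonneg) auto
    have "(\<lambda>y. ereal_sign (u x - u y)) \<in> borel_measurable lebesgue"
      unfolding s using u by measurable
    then show "?f \<in> borel_measurable lebesgue"
      using Kx by measurable
    show "AE y in lebesgue. norm (?f y) \<le> norm (K (x - y))"
      by (simp add: s)
  qed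
  then show ?thesis
    unfolding nl_curvature_def by (simp add: real_lebesgue_integral_def pos neg)
qed

text \<open>This is the formula \<open>P(E) = P(F) + \<integral> H\<close> with the curvature \<open>H\<close> split into its two halves. The
  pairs with both points in \<open>E - F\<close> contribute equally to the two integrals, by the symmetry of the
  kernel, so that only the exchange of \<open>E - F\<close> with \<open>F\<close> and with \<open>- E\<close> is left.\<close>

lemma nl_perimeter_flux:
  fixes K :: "'a::euclidean_space \<Rightarrow> real" and u :: "'a \<Rightarrow> ereal"
  assumes K: "K \<in> borel_measurable lebesgue" and even: "\<And>z. K (- z) = K z"
    and \<Omega>: "\<Omega> \<in> sets lebesgue" and F: "F \<in> sets lebesgue" and E: "E \<in> sets lebesgue"
    and FE: "F \<subseteq> E" "F - \<Omega> = E - \<Omega>"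
    and u: "u \<in> borel_measurable lebesgue"
    and uF: "\<And>x. u x = \<infinity> \<longleftrightarrow> x \<in> F" and uE: "\<And>x. u x = -\<infinity> \<longleftrightarrow> x \<notin> E"
  shows "nl_perimeter K \<Omega> E
      + (\<integral>\<^sup>+x\<in>E - F. (\<integral>\<^sup>+y\<in>{y. u x < u y}. ennreal (K (x - y)) \<partial>lebesgue) \<partial>lebesgue)
    = nl_perimeter K \<Omega> F
      + (\<integral>\<^sup>+x\<in>E - F. (\<integral>\<^sup>+y\<in>{y. u y < u x}. ennreal (K (x - y)) \<partial>lebesgue) \<partial>lebesgue)"
proof -
  let ?G = "E - F"
  define T where "T = {z. fst z \<in> ?G \<and> snd z \<in> ?G \<and> u (snd z) < u (fst z)}"
  have G: "?G \<in> sets lebesgue" and E': "- E \<in> sets lebesgue"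
    using E F by (auto simp: Compl_in_sets_lebesgue)
  have uG: "\<bar>u x\<bar> \<noteq> \<infinity> \<longleftrightarrow> x \<in> ?G" for x
    using uF[of x] uE[of x] by (cases "u x") auto
  have T_eq: "T = (?G \<times> ?G) \<inter> {z. u (snd z) < u (fst z)}"
    and S_eq: "prod.swap -` T = (?G \<times> ?G) \<inter> {z. u (fst z) < u (snd z)}"
    by (auto simp: T_def)
  have T: "T \<in> sets lebesgue" and S: "prod.swap -` T \<in> sets lebesgue"
    unfolding S_eq by (auto simp: T_eq intro!: sets.Int sets_lebesgue_Times G sets_lebesgue_less_pair u)
  have swap: "pair_interaction K (prod.swap -` T) = pair_interaction K T"
    by (rule pair_interaction_swap[OF K even T S])
  have above: "{z. fst z \<in> ?G \<and> u (fst z) < u (snd z)} = (?G \<times> F) \<union> prod.swap -` T"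
  proof (intro set_eqI)
    fix z :: "'a \<times> 'a"
    show "z \<in> {z. fst z \<in> ?G \<and> u (fst z) < u (snd z)} \<longleftrightarrow> z \<in> (?G \<times> F) \<union> prod.swap -` T"
      using uG[of "fst z"] uG[of "snd z"] uF[of "snd z"] uE[of "snd z"] FE
      by (cases z; cases "u (fst z)"; cases "u (snd z)") (auto simp: T_def)
  qed
  have below: "{z. fst z \<in> ?G \<and> u (snd z) < u (fst z)} = (?G \<times> (- E)) \<union> T"
  proof (intro set_eqI)
    fix z :: "'a \<times> 'a"
    show "z \<in> {z. fst z \<in> ?G \<and> u (snd z) < u (fst z)} \<longleftrightarrow> z \<in> (?G \<times> (- E)) \<union> T"
      using uG[of "fst z"] uG[of "snd z"] uF[of "snd z"] uE[of "snd z"] FE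
      by (cases z; cases "u (fst z)"; cases "u (snd z)") (auto simp: T_def)
  qed
  have disj: "(?G \<times> F) \<inter> prod.swap -` T = {}" "(?G \<times> (- E)) \<inter> T = {}"
    by (auto simp: T_def)
  have "(\<integral>\<^sup>+x\<in>?G. (\<integral>\<^sup>+y\<in>{y. u x < u y}. ennreal (K (x - y)) \<partial>lebesgue) \<partial>lebesgue)
      = pair_interaction K ((?G \<times> F) \<union> prod.swap -` T)"
    unfolding above[symmetric]
    by (rule nn_integral_section_eq_pair_interaction[OF K]) (simp only: above sets.Un sets_lebesgue_Times G F S)
  also have "\<dots> = nl_interaction K ?G F + pair_interaction K T"
    by (simp only: pair_interaction_Un[OF K sets_lebesgue_Times[OF G F] S disj(1)] swap
        nl_interaction_eq_pair_interaction[OF K G F])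
  finally have a: "(\<integral>\<^sup>+x\<in>?G. (\<integral>\<^sup>+y\<in>{y. u x < u y}. ennreal (K (x - y)) \<partial>lebesgue) \<partial>lebesgue)
      = nl_interaction K ?G F + pair_interaction K T" .
  have "(\<integral>\<^sup>+x\<in>?G. (\<integral>\<^sup>+y\<in>{y. u y < u x}. ennreal (K (x - y)) \<partial>lebesgue) \<partial>lebesgue)
      = pair_interaction K ((?G \<times> (- E)) \<union> T)"
    unfolding below[symmetric]
    by (rule nn_integral_section_eq_pair_interaction[OF K]) (simp only: below sets.Un sets_lebesgue_Times G E' T)
  also have "\<dots> = nl_interaction K ?G (- E) + pair_interaction K T"
    by (simp only: pair_interaction_Un[OF K sets_lebesgue_Times[OF G E'] T disj(2)]
        nl_interaction_eq_pair_interaction[OF K G E'])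
  finally have b: "(\<integral>\<^sup>+x\<in>?G. (\<integral>\<^sup>+y\<in>{y. u y < u x}. ennreal (K (x - y)) \<partial>lebesgue) \<partial>lebesgue)
      = nl_interaction K ?G (- E) + pair_interaction K T" .
  show ?thesis
    unfolding a b using nl_perimeter_exchange[OF K even \<Omega> F E FE] by (simp flip: add.assoc)
qed

lemma borel_measurable_nl_curvature:
  fixes K :: "'a::euclidean_space \<Rightarrow> real" and u :: "'a \<Rightarrow> ereal"
  assumes K: "K \<in> borel_measurable lebesgue" and nonneg: "\<And>z. K z \<ge> 0"
    and fin: "(\<integral>\<^sup>+z. ennreal (K z) \<partial>lebesgue) < \<infinity>"
    and u: "u \<in> borel_measurable lebesgue" and S: "\<And>x. x \<in> S \<Longrightarrow> \<bar>u x\<bar> \<noteq> \<infinity>"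
  shows "nl_curvature K u \<in> borel_measurable (lebesgue_on S)"
proof -
  define p where "p x = (\<integral>\<^sup>+y\<in>{y. u y < u x}. ennreal (K (x - y)) \<partial>lebesgue)" for x
  define q where "q x = (\<integral>\<^sup>+y\<in>{y. u x < u y}. ennreal (K (x - y)) \<partial>lebesgue)" for x
  have [measurable]: "p \<in> borel_measurable lebesgue" "q \<in> borel_measurable lebesgue"
    unfolding p_def[abs_def] q_def[abs_def]
    by (intro borel_measurable_nn_integral_sublevel borel_measurable_nn_integral_superlevel K u)+
  have "(\<lambda>x. enn2real (p x) - enn2real (q x)) \<in> borel_measurable (lebesgue_on S)"
    by (intro measurable_restrict_space1) measurable
  moreover have "nl_curvature K u x = enn2real (p x) - enn2real (q x)" if "x \<in> space (lebesgue_on S)" for x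
    unfolding p_def q_def using that by (intro nl_curvature_eq_diff[OF K nonneg fin u] S) simp
  ultimately show ?thesis
    by (subst measurable_cong[where g="\<lambda>x. enn2real (p x) - enn2real (q x)"])
qed

text \<open>For an integrable kernel this is \<open>P(E) = P(F) + \<integral> H\<close> once more, now rearranged so that every
  term is nonnegative; the integrand \<open>c - H\<close> is the one to which Fatou's lemma applies.\<close>

lemma nl_perimeter_curvature_balance:
  fixes K :: "'a::euclidean_space \<Rightarrow> real" and u :: "'a \<Rightarrow> ereal"
  assumes K: "K \<in> borel_measurable lebesgue" and nonneg: "\<And>z. K z \<ge> 0" and even: "\<And>z. K (- z) = K z"
    and fin: "(\<integral>\<^sup>+z. ennreal (K z) \<partial>lebesgue) < \<infinity>"
    and \<Omega>: "\<Omega> \<in> sets lebesgue" and F: "F \<in> sets lebesgue" and E: "E \<in> sets lebesgue"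
    and FE: "F \<subseteq> E" "F - \<Omega> = E - \<Omega>"
    and u: "u \<in> borel_measurable lebesgue"
    and uF: "\<And>x. u x = \<infinity> \<longleftrightarrow> x \<in> F" and uE: "\<And>x. u x = -\<infinity> \<longleftrightarrow> x \<notin> E"
    and Gfin: "emeasure lebesgue (E - F) < \<infinity>" and "c \<ge> 0"
    and le: "AE x in lebesgue_on (E - F). nl_curvature K u x \<le> c"
  shows "nl_perimeter K \<Omega> E + (\<integral>\<^sup>+x. ennreal (c - nl_curvature K u x) \<partial>lebesgue_on (E - F))
      = nl_perimeter K \<Omega> F + ennreal c * emeasure lebesgue (E - F)"
proof -
  let ?G = "E - F"
  let ?M = "lebesgue_on ?G"
  define p where "p x = (\<integral>\<^sup>+y\<in>{y. u y < u x}. ennreal (K (x - y)) \<partial>lebesgue)" for x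
  define q where "q x = (\<integral>\<^sup>+y\<in>{y. u x < u y}. ennreal (K (x - y)) \<partial>lebesgue)" for x
  have G: "?G \<in> sets lebesgue" using E F by auto
  have M_eq: "(\<integral>\<^sup>+x. f x \<partial>?M) = (\<integral>\<^sup>+x\<in>?G. f x \<partial>lebesgue)" for f :: "'a \<Rightarrow> ennreal"
    using G by (intro nn_integral_restrict_space) simp
  have M_space: "emeasure ?M (space ?M) = emeasure lebesgue ?G"
    using G by (simp add: emeasure_restrict_space)
  have p[measurable]: "p \<in> borel_measurable ?M" and q[measurable]: "q \<in> borel_measurable ?M"
    unfolding p_def[abs_def] q_def[abs_def]
    by (intro measurable_restrict_space1 borel_measurable_nn_integral_sublevel borel_measurable_nn_integral_superlevel K u)+
  have pfin: "p x < \<infinity>" and qfin: "q x < \<infinity>" for x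
    unfolding p_def q_def using section_integral_le[OF K] fin by (blast intro: le_less_trans)+
  have xG: "\<bar>u x\<bar> \<noteq> \<infinity>" if "x \<in> ?G" for x
    using that uF[of x] uE[of x] by (cases "u x") auto
  have H: "nl_curvature K u x = enn2real (p x) - enn2real (q x)" if "x \<in> ?G" for x
    unfolding p_def q_def
    by (rule nl_curvature_eq_diff[OF K nonneg fin u xG[OF that]])
  have [measurable]: "nl_curvature K u \<in> borel_measurable ?M"
    using xG by (intro borel_measurable_nl_curvature[OF K nonneg fin u]) auto
  let ?r = "\<lambda>x. ennreal (c - nl_curvature K u x)"
  have "AE x in ?M. p x + ?r x = ennreal c + q x"
    using le AE_space
  proof eventually_elim
    case (elim x)
    then have Hx: "nl_curvature K u x = enn2real (p x) - enn2real (q x)" by (simp add: H)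
    have "p x + ?r x = ennreal (enn2real (p x)) + ?r x"
      using pfin[of x] by simp
    also have "\<dots> = ennreal (c + enn2real (q x))"
      using elim(1) by (subst ennreal_plus[symmetric]) (auto simp: Hx)
    also have "\<dots> = ennreal c + q x"
      using qfin[of x] \<open>c \<ge> 0\<close> by simp
    finally show ?case .
  qed
  then have "(\<integral>\<^sup>+x. p x + ?r x \<partial>?M) = (\<integral>\<^sup>+x. ennreal c + q x \<partial>?M)"
    by (rule nn_integral_cong_AE)
  then have sum: "(\<integral>\<^sup>+x. p x \<partial>?M) + (\<integral>\<^sup>+x. ?r x \<partial>?M) = ennreal c * emeasure lebesgue ?G + (\<integral>\<^sup>+x. q x \<partial>?M)"
    by (simp add: nn_integral_add flip: M_space)
  have "(\<integral>\<^sup>+x. q x \<partial>?M) \<le> (\<integral>\<^sup>+x. (\<integral>\<^sup>+z. ennreal (K z) \<partial>lebesgue) \<partial>?M)"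
    unfolding q_def by (intro nn_integral_mono section_integral_le[OF K])
  also have "\<dots> < \<infinity>"
    using fin Gfin M_space by (simp add: ennreal_mult_less_top)
  finally have Q: "(\<integral>\<^sup>+x. q x \<partial>?M) < \<infinity>" .
  have flux: "nl_perimeter K \<Omega> E + (\<integral>\<^sup>+x. q x \<partial>?M) = nl_perimeter K \<Omega> F + (\<integral>\<^sup>+x. p x \<partial>?M)"
    unfolding M_eq p_def q_def by (rule nl_perimeter_flux[OF K even \<Omega> F E FE u uF uE])
  have "(\<integral>\<^sup>+x. q x \<partial>?M) + (nl_perimeter K \<Omega> E + (\<integral>\<^sup>+x. ?r x \<partial>?M))
      = (nl_perimeter K \<Omega> E + (\<integral>\<^sup>+x. q x \<partial>?M)) + (\<integral>\<^sup>+x. ?r x \<partial>?M)"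
    by (simp add: ac_simps)
  also have "\<dots> = nl_perimeter K \<Omega> F + ((\<integral>\<^sup>+x. p x \<partial>?M) + (\<integral>\<^sup>+x. ?r x \<partial>?M))"
    unfolding flux by (simp add: ac_simps)
  also have "\<dots> = (\<integral>\<^sup>+x. q x \<partial>?M) + (nl_perimeter K \<Omega> F + ennreal c * emeasure lebesgue ?G)"
    unfolding sum by (simp add: ac_simps)
  finally show "nl_perimeter K \<Omega> E + (\<integral>\<^sup>+x. ?r x \<partial>?M)
      = nl_perimeter K \<Omega> F + ennreal c * emeasure lebesgue ?G"
    using Q by (auto simp: ennreal_add_left_cancel)
qed

section \<open>Passage to the limit\<close>

lemma limsup_le_Limsup_at_right:
  fixes f :: "real \<Rightarrow> ereal"
  assumes "filterlim \<epsilon> (at_right a) sequentially"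
  shows "limsup (\<lambda>n. f (\<epsilon> n)) \<le> Limsup (at_right a) f"
proof (rule Limsup_greatest)
  fix P assume "eventually P (at_right a)"
  with assms have "\<forall>\<^sub>F n in sequentially. P (\<epsilon> n)"
    by (auto simp: filterlim_iff)
  then have "\<forall>\<^sub>F n in sequentially. f (\<epsilon> n) \<le> (SUP x\<in>Collect P. f x)"
    by eventually_elim (auto intro: SUP_upper)
  then show "limsup (\<lambda>n. f (\<epsilon> n)) \<le> (SUP x\<in>Collect P. f x)"
    by (rule Limsup_bounded)
qed

text \<open>The identity \<open>(c - g) + max g 0 = c + max (- g) 0\<close> for \<open>g = limsup h\<close>. The bound \<open>g \<le> c\<close> makes
  the truncation of \<open>c - g\<close> at \<open>0\<close> harmless; both sides are infinite when \<open>g = - \<infinity>\<close>.\<close>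

lemma liminf_ennreal_diff:
  fixes h :: "nat \<Rightarrow> real"
  assumes "c \<ge> 0" and le: "limsup (\<lambda>n. ereal (h n)) \<le> ereal c"
  shows "liminf (\<lambda>n. ennreal (c - h n)) + e2ennreal (limsup (\<lambda>n. ereal (h n)))
    = ennreal c + e2ennreal (- limsup (\<lambda>n. ereal (h n)))"
proof -
  let ?g = "limsup (\<lambda>n. ereal (h n))"
  have "liminf (\<lambda>n. ennreal (c - h n)) = liminf (\<lambda>n. e2ennreal (ereal (c - h n)))"
    by simp
  also have "\<dots> = e2ennreal (liminf (\<lambda>n. ereal c + - ereal (h n)))"
    by (subst Liminf_compose_continuous_mono)
      (auto simp: continuous_on_e2ennreal mono_def e2ennreal_mono)
  also have "liminf (\<lambda>n. ereal c + - ereal (h n)) = ereal c - ?g"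
    by (subst Liminf_add_ereal_left) (auto simp: ereal_Liminf_uminus minus_ereal_def simp del: uminus_ereal.simps)
  finally have eq: "liminf (\<lambda>n. ennreal (c - h n)) = e2ennreal (ereal c - ?g)" .
  show ?thesis
  proof (cases ?g)
    case (real r)
    with assms eq show ?thesis
      by (cases "r \<ge> 0") (auto simp: ennreal_neg simp flip: ennreal_plus)
  qed (use assms eq in auto)
qed

theorem theorem3p2:
  fixes K :: "real ^ 'n \<Rightarrow> real"
    and \<Omega> E F :: "(real ^ 'n) set"
    and \<phi> :: "real ^ 'n \<Rightarrow> real"
    and C\<^sub>0 \<epsilon>\<^sub>0 :: real
  assumes "K \<in> borel_measurable lebesgue"
    and "\<And>z. K z \<ge> 0"
    and "\<And>z. K (- z) = K z"
    and "(\<integral>\<^sup>+z. ennreal (min 1 (norm z) * K z) \<partial>lebesgue) < \<infinity>"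
    and "open \<Omega>" and "bounded \<Omega>"
    and "F \<in> sets lebesgue" and "E \<in> sets lebesgue"
    and "F \<subseteq> E" and "F - \<Omega> = E - \<Omega>"
    and "\<phi> \<in> borel_measurable (lebesgue_on (E - F))"
    and "\<epsilon>\<^sub>0 > 0"
    and "AE x in lebesgue_on (E - F). \<forall>\<epsilon>\<in>{0<..<\<epsilon>\<^sub>0}.
           nl_curvature (truncated_kernel K \<epsilon>) (level_function F E \<phi>) x \<le> C\<^sub>0"
    and "nl_perimeter K \<Omega> F < \<infinity>"
  shows "enn2ereal (nl_perimeter K \<Omega> E)
           \<le> enn2ereal (nl_perimeter K \<Omega> F)
             + ereal_integral (lebesgue_on (E - F)) (upper_nl_curvature K (level_function F E \<phi>))
         \<and> enn2ereal (nl_perimeter K \<Omega> F)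
             + ereal_integral (lebesgue_on (E - F)) (upper_nl_curvature K (level_function F E \<phi>))
           < \<infinity>"
proof -
  note K = assms(1) and nonneg = assms(2) and even = assms(3) and fin = assms(4)
    and F = assms(7) and E = assms(8) and FE = assms(9,10)
  define M where "M = lebesgue_on (E - F)"
  define u where "u = level_function F E \<phi>"
  \<comment> \<open>The constant function \<open>c\<close> is integrated with the nonnegative integral, so it must not be negative.\<close>
  define c where "c = max C\<^sub>0 0"
  \<comment> \<open>The offset 2 keeps the whole sequence strictly between \<open>0\<close> and \<open>\<epsilon>\<^sub>0\<close>.\<close>
  define \<epsilon> where "\<epsilon> k = \<epsilon>\<^sub>0 / real (k + 2)" for k
  define H where "H k = nl_curvature (truncated_kernel K (\<epsilon> k)) u" for k
  define P where "P k = nl_perimeter (truncated_kernel K (\<epsilon> k)) \<Omega>" for k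
  define g where "g x = limsup (\<lambda>k. ereal (H k x))" for x
  define U where "U = upper_nl_curvature K u"
  define m where "m = emeasure lebesgue (E - F)"

  have "c \<ge> 0" by (simp add: c_def)
  have \<Omega>: "\<Omega> \<in> sets lebesgue" using \<open>open \<Omega>\<close> by (simp add: borel_open)
  have G: "E - F \<in> sets lebesgue" using E F by auto
  have M_space: "emeasure M (space M) = m"
    using G by (simp add: M_def m_def emeasure_restrict_space)
  have m_fin: "m < \<infinity>"
  proof -
    have "m \<le> emeasure lebesgue \<Omega>"
      unfolding m_def using FE \<Omega> by (intro emeasure_mono) auto
    also have "\<dots> < \<infinity>"
      using \<open>open \<Omega>\<close> emeasure_bounded_finite[OF \<open>bounded \<Omega>\<close>] by (simp add: borel_open)
    finally show ?thesis .
  qed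
  have u: "u \<in> borel_measurable lebesgue"
    unfolding u_def by (rule borel_measurable_level_function[OF F E assms(11)])
  have uF: "u x = \<infinity> \<longleftrightarrow> x \<in> F" and uE: "u x = -\<infinity> \<longleftrightarrow> x \<notin> E" for x
    using FE(1) by (auto simp: u_def level_function_def)
  have uG: "\<bar>u x\<bar> \<noteq> \<infinity>" if "x \<in> E - F" for x
    using that by (simp add: u_def level_function_def)

  have \<epsilon>_pos: "0 < \<epsilon> k" and \<epsilon>_less: "\<epsilon> k < \<epsilon>\<^sub>0" for k
    using \<open>\<epsilon>\<^sub>0 > 0\<close> by (auto simp: \<epsilon>_def field_simps add_pos_nonneg)
  have \<epsilon>_dec: "\<epsilon> l \<le> \<epsilon> k" if "k \<le> l" for k l
    using that \<open>\<epsilon>\<^sub>0 > 0\<close> by (auto simp: \<epsilon>_def intro!: divide_left_mono)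
  have \<epsilon>_lim: "\<epsilon> \<longlonglongrightarrow> 0"
    unfolding \<epsilon>_def[abs_def] using lim_const_over_n[of \<epsilon>\<^sub>0] by (rule LIMSEQ_ignore_initial_segment)
  have \<epsilon>_right: "filterlim \<epsilon> (at_right 0) sequentially"
    using \<epsilon>_lim \<epsilon>_pos less_imp_neq[OF \<epsilon>_pos] by (auto simp: filterlim_at intro!: always_eventually)

  have ae_le: "AE x in M. \<forall>k. H k x \<le> c"
    using assms(13) unfolding M_def
    by eventually_elim (use \<epsilon>_pos \<epsilon>_less in \<open>auto simp: H_def u_def c_def le_max_iff_disj\<close>)
  have Kk: "truncated_kernel K (\<epsilon> k) \<in> borel_measurable lebesgue" for k
    by (rule borel_measurable_truncated_kernel[OF K])
  have ae_le_k: "AE x in lebesgue_on (E - F). nl_curvature (truncated_kernel K (\<epsilon> k)) u x \<le> c" for k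
    using ae_le unfolding M_def H_def by eventually_elim auto
  have even_k: "truncated_kernel K (\<epsilon> k) (- z) = truncated_kernel K (\<epsilon> k) z" for k z
    by (rule truncated_kernel_even) (rule even)
  note balance = nl_perimeter_curvature_balance[OF Kk truncated_kernel_nonneg[OF nonneg]
      even_k nn_integral_truncated_kernel_finite[OF K nonneg fin \<epsilon>_pos]
      \<Omega> F E FE u uF uE m_fin[unfolded m_def] \<open>c \<ge> 0\<close> ae_le_k]
  have H[measurable]: "H k \<in> borel_measurable M" for k
    unfolding H_def M_def using uG
    by (intro borel_measurable_nl_curvature[OF Kk truncated_kernel_nonneg[OF nonneg]
        nn_integral_truncated_kernel_finite[OF K nonneg fin \<epsilon>_pos] u])
  have bal: "P k E + (\<integral>\<^sup>+x. ennreal (c - H k x) \<partial>M) = P k F + ennreal c * m" for k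
    unfolding P_def H_def M_def m_def by (rule balance)
  have P_inc: "truncated_kernel K (\<epsilon> k) z \<le> truncated_kernel K (\<epsilon> l) z" if "k \<le> l" for k l z
    by (intro truncated_kernel_antimono nonneg \<epsilon>_dec that)
  have P_E: "nl_perimeter K \<Omega> E = (SUP k. P k E)"
    unfolding P_def using nonneg
    by (intro nl_perimeter_SUP_kernel Kk P_inc SUP_truncated_kernel \<epsilon>_lim \<Omega> E) auto
  have P_F: "P k F \<le> nl_perimeter K \<Omega> F" for k
    unfolding P_def by (intro nl_perimeter_mono_kernel truncated_kernel_le nonneg)

  let ?r = "\<lambda>k x. ennreal (c - H k x)"
  \<comment> \<open>Both summands on the left of \<open>bal\<close> pass to the limit: the perimeters increase in \<open>k\<close>, and the
    integrals are bounded below by the integrals of the increasing infima.\<close>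
  have fatou: "nl_perimeter K \<Omega> E + (\<integral>\<^sup>+x. liminf (\<lambda>k. ?r k x) \<partial>M)
      \<le> nl_perimeter K \<Omega> F + ennreal c * m"
  proof -
    let ?I = "\<lambda>k x. INF l\<in>{k..}. ?r l x"
    have I_inc: "incseq ?I"
      by (auto simp: incseq_def le_fun_def intro!: INF_superset_mono)
    have "(\<integral>\<^sup>+x. liminf (\<lambda>k. ?r k x) \<partial>M) = (SUP k. \<integral>\<^sup>+x. ?I k x \<partial>M)"
      unfolding liminf_SUP_INF by (rule nn_integral_monotone_convergence_SUP[OF I_inc]) measurable
    moreover have "(SUP k. P k E) + (SUP k. \<integral>\<^sup>+x. ?I k x \<partial>M) = (SUP k. P k E + (\<integral>\<^sup>+x. ?I k x \<partial>M))"
    proof (rule ennreal_SUP_add[symmetric])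
      show "incseq (\<lambda>k. P k E)"
        unfolding P_def by (intro incseq_SucI nl_perimeter_mono_kernel P_inc) simp
      show "incseq (\<lambda>k. \<integral>\<^sup>+x. ?I k x \<partial>M)"
        using I_inc by (intro incseq_SucI nn_integral_mono) (auto simp: incseq_def le_fun_def)
    qed
    moreover have "P k E + (\<integral>\<^sup>+x. ?I k x \<partial>M) \<le> nl_perimeter K \<Omega> F + ennreal c * m" for k
    proof -
      have "P k E + (\<integral>\<^sup>+x. ?I k x \<partial>M) \<le> P k E + (\<integral>\<^sup>+x. ?r k x \<partial>M)"
        by (intro add_left_mono nn_integral_mono INF_lower) simp
      also have "\<dots> \<le> nl_perimeter K \<Omega> F + ennreal c * m"
        unfolding bal by (intro add_right_mono P_F)
      finally show ?thesis .
    qed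
    ultimately show ?thesis
      unfolding P_E by (simp add: SUP_le_iff)
  qed

  have g[measurable]: "g \<in> borel_measurable M"
    unfolding g_def[abs_def] by measurable
  let ?pos = "\<lambda>f. \<integral>\<^sup>+x. e2ennreal (f x) \<partial>M"
  let ?neg = "\<lambda>f. \<integral>\<^sup>+x. e2ennreal (- f x) \<partial>M"
  have "AE x in M. liminf (\<lambda>k. ?r k x) + e2ennreal (g x) = ennreal c + e2ennreal (- g x)"
    using ae_le unfolding g_def
    by eventually_elim (auto intro!: liminf_ennreal_diff \<open>c \<ge> 0\<close> Limsup_bounded always_eventually)
  then have "(\<integral>\<^sup>+x. liminf (\<lambda>k. ?r k x) + e2ennreal (g x) \<partial>M) = (\<integral>\<^sup>+x. ennreal c + e2ennreal (- g x) \<partial>M)"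
    by (rule nn_integral_cong_AE)
  then have split: "(\<integral>\<^sup>+x. liminf (\<lambda>k. ?r k x) \<partial>M) + ?pos g = ennreal c * m + ?neg g"
    by (simp add: nn_integral_add flip: M_space)
  have "ennreal c * m + (nl_perimeter K \<Omega> E + ?neg g)
      = (nl_perimeter K \<Omega> E + (\<integral>\<^sup>+x. liminf (\<lambda>k. ?r k x) \<partial>M)) + ?pos g"
    by (simp only: split add.assoc) (simp only: add.left_commute)
  also have "\<dots> \<le> (nl_perimeter K \<Omega> F + ennreal c * m) + ?pos g"
    by (intro add_right_mono fatou)
  also have "\<dots> = ennreal c * m + (nl_perimeter K \<Omega> F + ?pos g)"
    by (simp add: ac_simps)
  finally have seq: "nl_perimeter K \<Omega> E + ?neg g \<le> nl_perimeter K \<Omega> F + ?pos g"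
    using m_fin by (subst (asm) ennreal_add_left_cancel_le) (auto simp: ennreal_mult_eq_top_iff)

  \<comment> \<open>Monotonicity of the integral needs no measurability, so \<open>g\<close> can be replaced by \<open>U\<close>.\<close>
  have gU: "g x \<le> U x" for x
    unfolding g_def U_def upper_nl_curvature_def H_def by (rule limsup_le_Limsup_at_right[OF \<epsilon>_right])
  have "AE x in M. U x \<le> ereal c"
    using assms(13) unfolding M_def
  proof eventually_elim
    case (elim x)
    have "\<forall>\<^sub>F e in at_right 0. e \<in> {0<..<\<epsilon>\<^sub>0}"
      by (rule eventually_at_right_real[OF \<open>\<epsilon>\<^sub>0 > 0\<close>])
    then show ?case
      unfolding U_def upper_nl_curvature_def
      by (intro Limsup_bounded, elim eventually_mono)
        (use elim in \<open>auto simp: u_def c_def le_max_iff_disj\<close>)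
  qed
  then have "?pos U \<le> (\<integral>\<^sup>+x. ennreal c \<partial>M)"
    by (intro nn_integral_mono_AE) (auto elim!: eventually_mono dest: e2ennreal_mono)
  also have "\<dots> < \<infinity>"
    using m_fin by (simp add: M_space ennreal_mult_less_top)
  finally have U_fin: "?pos U < \<infinity>" .
  have "nl_perimeter K \<Omega> E + ?neg U \<le> nl_perimeter K \<Omega> E + ?neg g"
    using gU by (intro add_left_mono nn_integral_mono e2ennreal_mono) simp
  also note seq
  also have "nl_perimeter K \<Omega> F + ?pos g \<le> nl_perimeter K \<Omega> F + ?pos U"
    using gU by (intro add_left_mono nn_integral_mono e2ennreal_mono) simp
  finally have final: "nl_perimeter K \<Omega> E + ?neg U \<le> nl_perimeter K \<Omega> F + ?pos U" .
  have "enn2ereal a \<le> enn2ereal b + (enn2ereal p - enn2ereal q)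
      \<and> enn2ereal b + (enn2ereal p - enn2ereal q) < \<infinity>"
    if "a + q \<le> b + p" "b < \<infinity>" "p < \<infinity>" for a b p q :: ennreal
    using that by (cases a; cases b; cases p; cases q) (auto simp: top_unique simp flip: ennreal_plus)
  from this[OF final \<open>nl_perimeter K \<Omega> F < \<infinity>\<close> U_fin]
  show ?thesis
    unfolding ereal_integral_def U_def u_def M_def .
qed

end
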